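(* If the diagonal entries of $\hat{\Sigma}$ are strictly positive, then the sequence of iterates generated by the cyclic coordinatewise minimization algorithm for $Q_{con}$ converges.
   Context: Let $p\ge1$ be an integer, $\lambda>0$, and let $\hat\Sigma$ be the $p\times p$ sample covariance matrix of $n$ observations of a $p$-variate distribution; it enters only as a real symmetric positive semi-definite $p\times p$ matrix (possibly singular). For a real symmetric $p\times p$ matrix $\Omega=(\omega_{ij})$ with non-negative diagonal entries, with $i$-th column $\Omega_{\cdot i}$, define $$Q_{con}(\Omega)=\sum_{i=1}^p-\log\omega_{ii}+\frac12\sum_{i=1}^p\Omega_{\cdot i}^T\hat\Sigma\,\Omega_{\cdot i}+\lambda\sum_{1\le i<j\le p}|\omega_{ij}|,$$ with $-\log 0=+\infty$. Cyclic coordinatewise minimization algorithm for $Q_{con}$ (the CONCORD algorithm). The coordinates are the $p(p+1)/2$ numbers $\omega_{ij}$, $1\le i\le j\le p$ (with $\omega_{ji}=\omega_{ij}$), listed in a fixed order. Start from a symmetric matrix $\Omega^0$ with non-negative diagonal and $Q_{con}(\Omega^0)<\infty$. Given $\Omega^r$, go once through all coordinates in the fixed order, each time replacing the current coordinate by the (unique) value minimizing $Q_{con}$ with all other coordinates held at their current values, subject to diagonal entries being non-negative; the matrix obtained after the full pass is $\Omega^{r+1}$. The iterates are $\{\Omega^r\}_{r\ge 0}$ (the algorithm is run indefinitely). *)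

theory Defs
  imports "HOL-Analysis.Analysis"
begin

text \<open>Matrices are indexed by a finite linearly ordered type \<open>'p\<close>, which plays the role of
  \<open>{1, \<dots>, p}\<close> with \<open>p = CARD('p)\<close>. The type synonym is \<open>real^'p^'p\<close>; that notation would attach the sort
  \<open>finite\<close> to each \<open>'p\<close>, which clashes with the sort \<open>{finite,linorder}\<close>.\<close>

type_synonym 'p sqmat = "((real, 'p) vec, 'p) vec"

definition psd_matrix :: "('p::finite) sqmat \<Rightarrow> bool" where
  "psd_matrix S \<longleftrightarrow> transpose S = S \<and> (\<forall>x. 0 \<le> x \<bullet> (S *v x))"

text \<open>The convention \<open>- log 0 = \<infinity>\<close>. Since \<open>ln\<close> is total in HOL (with \<open>ln 0 = 0\<close>), it has to be
  made explicit. Negative arguments lie outside the intended domain.\<close>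

definition neg_log :: "real \<Rightarrow> ereal" where
  "neg_log x = (if x > 0 then ereal (- ln x) else \<infinity>)"

definition Q_con :: "('p::{finite,linorder}) sqmat \<Rightarrow> real \<Rightarrow> 'p sqmat \<Rightarrow> ereal" where
  "Q_con S lam W =
     (\<Sum>i\<in>UNIV. neg_log (W $ i $ i))
     + ereal (1/2 * (\<Sum>i\<in>UNIV. column i W \<bullet> (S *v column i W))
              + lam * (\<Sum>(i, j)\<in>{(i, j). i < j}. \<bar>W $ i $ j\<bar>))"

text \<open>A coordinate is a pair \<open>(i, j)\<close> with \<open>i \<le> j\<close>. It stands for both symmetric entries, so
  setting it changes entry \<open>(i, j)\<close> and entry \<open>(j, i)\<close>.\<close>

definition coords :: "('p::{finite,linorder} \<times> 'p) set" where
  "coords = {(i, j). i \<le> j}"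

definition set_coord :: "('p::finite) sqmat \<Rightarrow> 'p \<times> 'p \<Rightarrow> real \<Rightarrow> 'p sqmat" where
  "set_coord W c x =
     (\<chi> a b. if (a, b) = c \<or> (b, a) = c then x else W $ a $ b)"

text \<open>The minimizing value is unique whenever the diagonal of \<open>S\<close> is positive and \<open>Q_con S lam W\<close>
  is finite. Outside that situation the definite description may be unspecified.\<close>

definition coord_min :: "('p::{finite,linorder}) sqmat \<Rightarrow> real \<Rightarrow> 'p sqmat \<Rightarrow> 'p \<times> 'p \<Rightarrow> real" where
  "coord_min S lam W c =
     (THE x. is_arg_min (\<lambda>x. Q_con S lam (set_coord W c x))
                        (\<lambda>x. fst c = snd c \<longrightarrow> 0 \<le> x) x)"

definition coord_step :: "('p::{finite,linorder}) sqmat \<Rightarrow> real \<Rightarrow> 'p \<times> 'p \<Rightarrow> 'p sqmat \<Rightarrow> 'p sqmat" where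
  "coord_step S lam c W = set_coord W c (coord_min S lam W c)"

text \<open>One full pass through the coordinates in the order \<open>cs\<close>, each step starting from the
  matrix left by the previous one.\<close>

definition concord_pass ::
    "('p::{finite,linorder}) sqmat \<Rightarrow> real \<Rightarrow> ('p \<times> 'p) list \<Rightarrow> 'p sqmat \<Rightarrow> 'p sqmat" where
  "concord_pass S lam cs W = fold (coord_step S lam) cs W"

definition concord_iterate ::
    "('p::{finite,linorder}) sqmat \<Rightarrow> real \<Rightarrow> ('p \<times> 'p) list \<Rightarrow> 'p sqmat \<Rightarrow> nat \<Rightarrow> 'p sqmat" where
  "concord_iterate S lam cs W0 r = (concord_pass S lam cs ^^ r) W0"

end

theory Submission
  imports Defs
begin

text \<open>
  In the independent entries \<open>x\<close> of a symmetric matrix the objective has the form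
  \<open>\<Sum>\<^sub>d - ln x\<^sub>d + 1/2 B(x, x) + \<lambda> \<Sum>\<^sub>c \<bar>x\<^sub>c\<bar>\<close>, where \<open>d\<close> runs over the diagonal entries, \<open>c\<close> over the
  off-diagonal ones, and \<open>B\<close> is positive semidefinite. It is convex, but as \<open>B\<close> may be degenerate
  it need not be strictly convex and may have many minimizers. Descent in the objective and
  compactness therefore give only that limit points of the iterates are minimizers. Convergence of
  the sequence itself comes from a geometric rate: the steps have summable length.

  Let \<open>gap\<close> be the distance of the objective to its minimum, and \<open>d\<close> the length of one full pass.
  Three inequalities give the rate.

  \<^item> Every coordinate has positive curvature, because the diagonal of \<open>S\<close> is positive. So a pass
    lowers the objective by at least a multiple of \<open>d\<^sup>2\<close> (\<open>fold_update\<close>).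

  \<^item> Each coordinate was optimal at some moment of the pass, and since then the point has moved by at
    most \<open>d\<close>. So after the pass there is a subgradient of size \<open>O(d)\<close>, and
    \<open>gap \<le> O(d) \<cdot> \<parallel>x - z\<parallel>\<close> for every minimizer \<open>z\<close> (\<open>gap_le_pass_length\<close>). The barrier is
    unbounded, but its derivative in a coordinate depends on that coordinate only and does not change
    after its update.

  \<^item> On a sublevel set some minimizer \<open>z\<close> satisfies \<open>\<parallel>x - z\<parallel>\<^sup>2 \<le> O(gap)\<close> (\<open>error_bound\<close>).

  Together they give \<open>gap = O(d\<^sup>2)\<close> after a pass, hence the gap shrinks by a constant factor in every
  pass, and \<open>d\<close> decays geometrically (\<open>cyclic_descent_convergent\<close>).

  The error bound holds because the set of minimizers is polyhedral. Fix one minimizer \<open>x\<^sup>*\<close>. The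
  minimizers found below are the points that agree with \<open>x\<^sup>*\<close> on the diagonal and modulo the kernel
  of \<open>B\<close>, and at whose off-diagonal entries the nonnegative piecewise linear functions
  \<open>p\<^sub>c(t) = g\<^sub>c t + \<lambda> \<bar>t\<bar>\<close> vanish, \<open>g\<close> being the gradient of the smooth part at \<open>x\<^sup>*\<close>. The gap
  dominates the violation of the sign constraints \<open>p\<^sub>c = 0\<close> linearly and that of the equations
  quadratically. To pass from violation to distance one needs a bound of Hoffman type, which
  \<open>conformal_bound\<close> supplies.
\<close>

section \<open>A Hoffman-type bound for positive semidefinite forms\<close>

locale psd_form = bounded_bilinear B
  for B :: "real^'c::finite \<Rightarrow> real^'c \<Rightarrow> real" +
  assumes sym: "B x y = B y x" and nonneg: "0 \<le> B x x"
begin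

lemma quad_add: "B (x + y) (x + y) = B x x + 2 * B x y + B y y"
  by (simp add: add_left add_right sym[of y x])

lemma quad_diff: "B (x - y) (x - y) = B x x - 2 * B x y + B y y"
  by (simp add: diff_left diff_right sym[of y x])

lemma quad_diff_le: "B (x - y) (x - y) \<le> 2 * B x x + 2 * B y y"
  using quad_diff[of x y] quad_add[of x y] nonneg[of "x + y"] by linarith

text \<open>Along the line \<open>t n + y\<close> the form is affine in \<open>t\<close>, so nonnegativity forces slope zero.\<close>

lemma null_orthogonal:
  assumes "B n n = 0"
  shows "B n y = 0"
proof (rule ccontr)
  assume ne: "B n y \<noteq> 0"
  define t where "t = - (B y y + 1) / (2 * B n y)"
  have "0 \<le> B (t *\<^sub>R n + y) (t *\<^sub>R n + y)"
    by (rule nonneg)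
  also have "\<dots> = 2 * t * B n y + B y y"
    using assms by (simp add: quad_add scaleR_left scaleR_right)
  also have "\<dots> = -1"
    using ne by (simp add: t_def field_simps)
  finally show False
    by simp
qed

lemma continuous_on_quad: "continuous_on A (\<lambda>x. B x x)"
  by (intro continuous_on continuous_intros)

lemma quad_le_norm: obtains K where "K > 0" "\<And>x y. \<bar>B x y\<bar> \<le> K * norm x * norm y"
  using pos_bounded by (metis mult.commute mult.left_commute real_norm_def)

text \<open>On the compact set of unit vectors of the cone the form has a positive minimum, and
  homogeneity does the rest.\<close>

lemma definite_on_cone:
  assumes closed: "closed C"
    and cone: "\<And>a x. a \<ge> 0 \<Longrightarrow> x \<in> C \<Longrightarrow> a *\<^sub>R x \<in> C"
    and definite: "\<And>x. x \<in> C \<Longrightarrow> B x x = 0 \<Longrightarrow> x = 0"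
  shows "\<exists>k>0. \<forall>x\<in>C. k * (norm x)\<^sup>2 \<le> B x x"
proof (cases "C \<inter> sphere 0 1 = {}")
  case True
  have "x = 0" if "x \<in> C" for x
  proof (rule ccontr)
    assume "x \<noteq> 0"
    then have "(1 / norm x) *\<^sub>R x \<in> C \<inter> sphere 0 1"
      using that cone by simp
    then show False using True by blast
  qed
  then have "\<forall>x\<in>C. 1 * (norm x)\<^sup>2 \<le> B x x"
    using nonneg by fastforce
  then show ?thesis
    using zero_less_one by blast
next
  case False
  have "compact (C \<inter> sphere 0 1)"
    using closed by (simp add: closed_Int_compact)
  then obtain u where u: "u \<in> C \<inter> sphere 0 1" "\<And>x. x \<in> C \<inter> sphere 0 1 \<Longrightarrow> B u u \<le> B x x"
    using continuous_attains_inf[OF _ False continuous_on_quad] by blast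
  then have "B u u > 0"
    using definite[of u] nonneg[of u] by (force simp: less_le)
  moreover have "B u u * (norm x)\<^sup>2 \<le> B x x" if "x \<in> C" for x
  proof (cases "x = 0")
    case True
    then show ?thesis by (simp add: zero_left)
  next
    case False
    then have "(1 / norm x) *\<^sub>R x \<in> C \<inter> sphere 0 1"
      using that cone by simp
    from u(2)[OF this] have "B u u \<le> B x x / (norm x)\<^sup>2"
      by (simp add: scaleR_left scaleR_right power2_eq_square)
    then show ?thesis
      using False by (simp add: field_simps)
  qed
  ultimately show ?thesis by blast
qed

text \<open>
  Up to null vectors, \<open>w\<close> can be replaced by some \<open>v\<close> whose entries lie between \<open>0\<close> and those of \<open>w\<close>
  and whose norm the form controls. Keeping the signs is the point: for two points of a product of
  intervals with difference \<open>w\<close>, moving from one towards the other by \<open>v\<close> stays in the product.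

  Among the vectors with the first two properties take \<open>v\<close> of least \<open>l\<^sub>1\<close> norm. If the closed orthant face spanned by the signs of \<open>v\<close> contained
  a nonzero null vector \<open>n\<close>, then subtracting a small multiple of \<open>n\<close> would shorten \<open>v\<close>. So the form is
  definite on that face and bounds the norm there, by a constant that depends only on the face; there
  are finitely many faces.
\<close>

lemma conformal_bound:
  "\<exists>k>0. \<forall>w. \<exists>v. (\<forall>c. min 0 (w $ c) \<le> v $ c \<and> v $ c \<le> max 0 (w $ c))
     \<and> B (w - v) (w - v) = 0 \<and> k * (norm v)\<^sup>2 \<le> B w w"
proof -
  \<comment> \<open>A face is given by the coordinates allowed to be positive and those allowed to be negative.\<close>
  define face :: "'c set \<times> 'c set \<Rightarrow> (real^'c) set" where
    "face s = {x. \<forall>c. (c \<notin> fst s \<longrightarrow> x $ c \<le> 0) \<and> (c \<notin> snd s \<longrightarrow> 0 \<le> x $ c)}" for s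
  define definite where "definite s \<longleftrightarrow> (\<forall>x\<in>face s. B x x = 0 \<longrightarrow> x = 0)" for s
  have "\<exists>k>0. definite s \<longrightarrow> (\<forall>x\<in>face s. k * (norm x)\<^sup>2 \<le> B x x)" for s
  proof (cases "definite s")
    case True
    have "closed (face s)"
      unfolding face_def
      by (intro closed_Collect_all closed_Collect_conj closed_Collect_imp open_Collect_const
          closed_Collect_le continuous_intros)
    moreover have "a *\<^sub>R x \<in> face s" if "a \<ge> 0" "x \<in> face s" for a x
      using that by (auto simp: face_def mult_nonneg_nonpos)
    ultimately show ?thesis
      using definite_on_cone[of "face s"] True by (auto simp: definite_def)
  qed (use zero_less_one in blast)
  then obtain K where K: "\<And>s. K s > 0"
    "\<And>s x. definite s \<Longrightarrow> x \<in> face s \<Longrightarrow> K s * (norm x)\<^sup>2 \<le> B x x"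
    by metis
  define k where "k = Min (range K)"
  have "k > 0" "\<And>s. k \<le> K s"
    using K(1) by (auto simp: k_def)
  moreover
  have "\<exists>v. (\<forall>c. min 0 (w $ c) \<le> v $ c \<and> v $ c \<le> max 0 (w $ c))
     \<and> B (w - v) (w - v) = 0 \<and> k * (norm v)\<^sup>2 \<le> B w w" for w
  proof -
    define T where "T = cbox (\<chi> c. min 0 (w $ c)) (\<chi> c. max 0 (w $ c)) \<inter> {v. B (w - v) (w - v) = 0}"
    have in_T: "v \<in> T \<longleftrightarrow> (\<forall>c. min 0 (w $ c) \<le> v $ c \<and> v $ c \<le> max 0 (w $ c))
      \<and> B (w - v) (w - v) = 0" for v
      by (simp add: T_def mem_box_cart)
    have "closed {v. B (w - v) (w - v) = 0}"
      by (intro closed_Collect_eq continuous_on continuous_intros)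
    then have "compact T"
      unfolding T_def by (simp add: compact_Int_closed)
    moreover have "w \<in> T"
      by (simp add: in_T zero_left)
    moreover have "continuous_on T (\<lambda>v. \<Sum>c\<in>UNIV. \<bar>v $ c\<bar>)"
      by (intro continuous_intros)
    ultimately obtain v where v: "v \<in> T" "\<And>u. u \<in> T \<Longrightarrow> (\<Sum>c\<in>UNIV. \<bar>v $ c\<bar>) \<le> (\<Sum>c\<in>UNIV. \<bar>u $ c\<bar>)"
      using continuous_attains_inf[of T] by blast
    define s where "s = ({c. v $ c > 0}, {c. v $ c < 0})"
    have "definite s"
      unfolding definite_def
    proof (intro ballI impI, rule ccontr)
      fix n assume n: "n \<in> face s" "B n n = 0" "n \<noteq> 0"
      then obtain a where a: "n $ a \<noteq> 0"
        by (metis vec_eq_iff zero_index)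
      have sgn: "(n $ c > 0 \<longrightarrow> v $ c > 0) \<and> (n $ c < 0 \<longrightarrow> v $ c < 0)" for c
        using n(1) by (simp add: face_def s_def) (meson not_le)
      \<comment> \<open>The largest step for which no entry of \<open>v\<close> overshoots zero.\<close>
      define Z where "Z = {c. n $ c \<noteq> 0}"
      define e where "e = Min ((\<lambda>c. v $ c / n $ c) ` Z)"
      have Z: "finite Z" "Z \<noteq> {}"
        using a by (auto simp: Z_def)
      have "v $ c / n $ c > 0" if "c \<in> Z" for c
        using sgn[of c] that by (auto simp: Z_def zero_less_divide_iff linorder_neq_iff)
      then have e_pos: "e > 0"
        using Z by (simp add: e_def)
      have e_le: "e \<le> v $ c / n $ c" if "c \<in> Z" for c
        using that Z by (simp add: e_def)
      have step: "(0 \<le> n $ c \<and> 0 \<le> e * n $ c \<and> e * n $ c \<le> v $ c)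
          \<or> (n $ c \<le> 0 \<and> v $ c \<le> e * n $ c \<and> e * n $ c \<le> 0) \<or> n $ c = 0" for c
      proof (cases "c \<in> Z")
        case True
        then consider "n $ c > 0" | "n $ c < 0"
          by (force simp: Z_def linorder_neq_iff)
        then show ?thesis
          using e_le[OF True] e_pos
          by cases (auto simp: field_simps mult_le_0_iff zero_le_mult_iff)
      qed (simp add: Z_def)
      have "v - e *\<^sub>R n \<in> T"
      proof -
        have "B (w - v + e *\<^sub>R n) (w - v + e *\<^sub>R n) = 0"
          using v(1) n(2) null_orthogonal[of "w - v"]
          by (simp add: in_T quad_add scaleR_left scaleR_right)
        moreover have "min 0 (w $ c) \<le> (v - e *\<^sub>R n) $ c \<and> (v - e *\<^sub>R n) $ c \<le> max 0 (w $ c)" for c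
        proof -
          have "min 0 (w $ c) \<le> v $ c \<and> v $ c \<le> max 0 (w $ c)"
            using v(1) by (simp add: in_T)
          then show ?thesis
            using step[of c] by (auto simp: min_def max_def split: if_splits)
        qed
        ultimately show ?thesis
          by (simp add: in_T algebra_simps)
      qed
      from v(2)[OF this] have "(\<Sum>c\<in>UNIV. \<bar>v $ c\<bar>) \<le> (\<Sum>c\<in>UNIV. \<bar>(v - e *\<^sub>R n) $ c\<bar>)" .
      moreover have "(\<Sum>c\<in>UNIV. \<bar>(v - e *\<^sub>R n) $ c\<bar>) < (\<Sum>c\<in>UNIV. \<bar>v $ c\<bar>)"
      proof (rule sum_strict_mono_ex1)
        show "\<forall>c\<in>UNIV. \<bar>(v - e *\<^sub>R n) $ c\<bar> \<le> \<bar>v $ c\<bar>"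
        proof
          fix c show "\<bar>(v - e *\<^sub>R n) $ c\<bar> \<le> \<bar>v $ c\<bar>"
            using step[of c] by (auto simp: abs_if)
        qed
        have "e * n $ a \<noteq> 0" using a e_pos by simp
        then have "\<bar>v $ a - e * n $ a\<bar> < \<bar>v $ a\<bar>"
          using step[of a] a by linarith
        then show "\<exists>c\<in>UNIV. \<bar>(v - e *\<^sub>R n) $ c\<bar> < \<bar>v $ c\<bar>"
          by (intro bexI[of _ a]) simp_all
      qed simp
      ultimately show False by simp
    qed
    moreover have "v \<in> face s"
      by (auto simp: face_def s_def)
    ultimately have "K s * (norm v)\<^sup>2 \<le> B v v"
      by (rule K(2))
    then have "k * (norm v)\<^sup>2 \<le> B v v"
      using \<open>\<And>s. k \<le> K s\<close>[of s] by (meson mult_right_mono order_trans zero_le_power2)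
    moreover have "B v v = B w w"
      using v(1) null_orthogonal[of "w - v" v] quad_add[of "w - v" v] by (simp add: in_T)
    ultimately show ?thesis
      using v(1) by (auto simp: in_T)
  qed
  ultimately show ?thesis by blast
qed

end

section \<open>Logarithmic barrier, quadratic form and \<open>l\<^sub>1\<close> penalty\<close>

text \<open>The coordinates in \<open>D\<close> carry the barrier and the others the penalty. Definiteness of \<open>B\<close> on the
  span of \<open>D\<close> makes the objective coercive: in these directions the barrier decreases without
  bound and the penalty does not grow.\<close>

locale log_l1_quadratic = psd_form B
  for B :: "real^'c::finite \<Rightarrow> real^'c \<Rightarrow> real" +
  fixes D :: "'c set" and lam :: real
  assumes lam_pos: "lam > 0"
    and diag_definite: "\<And>x. (\<And>c. c \<notin> D \<Longrightarrow> x $ c = 0) \<Longrightarrow> B x x = 0 \<Longrightarrow> x = 0"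
    and coord_pos: "\<And>c. B (axis c 1) (axis c 1) > 0"
begin

definition feasible :: "(real^'c) set" where
  "feasible = {x. \<forall>d\<in>D. x $ d > 0}"

definition weight :: "'c \<Rightarrow> real" where
  "weight c = (if c \<in> D then 0 else lam)"

definition l1 :: "real^'c \<Rightarrow> real" where
  "l1 x = (\<Sum>c\<in>UNIV. weight c * \<bar>x $ c\<bar>)"

definition objective :: "real^'c \<Rightarrow> real" where
  "objective x = (\<Sum>d\<in>D. - ln (x $ d)) + 1/2 * B x x + l1 x"

text \<open>The directional derivative at \<open>x\<close> of the smooth part (barrier plus quadratic form).\<close>

definition slope :: "real^'c \<Rightarrow> real^'c \<Rightarrow> real" where
  "slope x v = B x v - (\<Sum>d\<in>D. v $ d / x $ d)"

text \<open>A lower bound for the Bregman distance of the barrier, with the square root making the strong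
  convexity of \<open>- ln\<close> an algebraic matter.\<close>

definition barrier_dist :: "real^'c \<Rightarrow> real^'c \<Rightarrow> real" where
  "barrier_dist x y = (\<Sum>d\<in>D. (sqrt (y $ d / x $ d) - 1)\<^sup>2)"

lemma weight_nonneg: "0 \<le> weight c"
  using lam_pos by (simp add: weight_def)

lemma l1_nonneg: "0 \<le> l1 x"
  by (simp add: l1_def sum_nonneg weight_nonneg)

lemma l1_scale: "l1 (a *\<^sub>R x) = \<bar>a\<bar> * l1 x"
  by (simp add: l1_def abs_mult sum_distrib_left mult_ac)

lemma l1_convex:
  assumes "0 \<le> s" "s \<le> 1"
  shows "l1 (x + s *\<^sub>R (y - x)) - l1 x \<le> s * (l1 y - l1 x)"
proof -
  have "weight c * \<bar>(x + s *\<^sub>R (y - x)) $ c\<bar> \<le> (1 - s) * (weight c * \<bar>x $ c\<bar>) + s * (weight c * \<bar>y $ c\<bar>)" for c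
  proof -
    have "\<bar>(x + s *\<^sub>R (y - x)) $ c\<bar> = \<bar>(1 - s) * x $ c + s * y $ c\<bar>"
      by (simp add: algebra_simps)
    also have "\<dots> \<le> (1 - s) * \<bar>x $ c\<bar> + s * \<bar>y $ c\<bar>"
      using assms by (intro order_trans[OF abs_triangle_ineq]) (simp add: abs_mult)
    finally show ?thesis
      using mult_left_mono[OF _ weight_nonneg[of c]] by (fastforce simp: algebra_simps)
  qed
  then have "l1 (x + s *\<^sub>R (y - x)) \<le> (1 - s) * l1 x + s * l1 y"
    unfolding l1_def sum_distrib_left sum.distrib[symmetric] by (rule sum_mono)
  then show ?thesis by (simp add: algebra_simps)
qed

lemma slope_add: "slope x (v + w) = slope x v + slope x w"
  by (simp add: slope_def add_right add_divide_distrib sum.distrib)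

lemma slope_scale: "slope x (a *\<^sub>R v) = a * slope x v"
  by (simp add: slope_def scaleR_right sum_distrib_left algebra_simps)

lemma linear_slope: "linear (slope x)"
  by (rule linearI) (simp_all add: slope_add slope_scale)

lemma slope_coords: "slope x v = (\<Sum>c\<in>UNIV. v $ c * slope x (axis c 1))"
proof -
  have "v = (\<Sum>c\<in>UNIV. v $ c *\<^sub>R axis c 1)"
    by (simp add: basis_expansion flip: scalar_mult_eq_scaleR)
  then have "slope x v = slope x (\<Sum>c\<in>UNIV. v $ c *\<^sub>R axis c 1)"
    by simp
  also have "\<dots> = (\<Sum>c\<in>UNIV. v $ c * slope x (axis c 1))"
    by (simp add: linear_sum[OF linear_slope] slope_scale)
  finally show ?thesis .
qed

lemma slope_axis: "slope x (axis c 1) = B x (axis c 1) - (if c \<in> D then 1 / x $ c else 0)"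
proof -
  have "(\<Sum>d\<in>D. axis c 1 $ d / x $ d) = (\<Sum>d\<in>D. if d = c then 1 / x $ c else 0)"
    by (rule sum.cong) (auto simp: axis_def)
  then show ?thesis by (simp add: slope_def)
qed

text \<open>Write \<open>ln t = 2 ln (sqrt t) \<le> 2 (sqrt t - 1) = (t - 1) - (sqrt t - 1)\<^sup>2\<close> with \<open>t = b / a\<close>. The
  usual tangent estimate, applied to the square root, gains the quadratic term.\<close>

lemma neg_ln_lower:
  assumes "0 < a" "0 < (b::real)"
  shows "- ln a - (b - a) / a + (sqrt (b / a) - 1)\<^sup>2 \<le> - ln b"
proof -
  have "ln b - ln a = 2 * ln (sqrt (b / a))"
    using assms by (simp add: ln_sqrt ln_div)
  also have "\<dots> \<le> 2 * (sqrt (b / a) - 1)"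
    using assms ln_le_minus_one[of "sqrt (b / a)"] by simp
  also have "\<dots> = (b - a) / a - (sqrt (b / a) - 1)\<^sup>2"
    using assms by (simp add: power2_diff diff_divide_distrib)
  finally show ?thesis by simp
qed

lemma objective_lower:
  assumes "x \<in> feasible" "y \<in> feasible"
  shows "objective x + slope x (y - x) + (l1 y - l1 x) + 1/2 * B (y - x) (y - x) + barrier_dist x y \<le> objective y"
proof -
  have "(\<Sum>d\<in>D. - ln (x $ d) - (y $ d - x $ d) / x $ d + (sqrt (y $ d / x $ d) - 1)\<^sup>2)
    \<le> (\<Sum>d\<in>D. - ln (y $ d))"
    using assms by (intro sum_mono neg_ln_lower) (auto simp: feasible_def)
  then have "(\<Sum>d\<in>D. - ln (x $ d)) - (\<Sum>d\<in>D. (y - x) $ d / x $ d) + barrier_dist x y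
    \<le> (\<Sum>d\<in>D. - ln (y $ d))"
    by (simp add: sum.distrib sum_subtractf barrier_dist_def sum_negf)
  moreover have "B y y = B x x + 2 * B x (y - x) + B (y - x) (y - x)"
    using quad_add[of x "y - x"] by simp
  ultimately show ?thesis
    unfolding objective_def slope_def by (simp add: algebra_simps)
qed

lemma barrier_dist_nonneg: "0 \<le> barrier_dist x y"
  by (simp add: barrier_dist_def sum_nonneg)

text \<open>Optimality is assumed only on the segment towards \<open>y\<close>, so that the same lemma serves global
  minimizers and coordinatewise ones. The convexity inequality based at the points
  \<open>x + s (y - x)\<close> bounds the difference quotient by a slope, which is continuous as \<open>s\<close> tends to
  \<open>0\<close>.\<close>

lemma variational_inequality:
  assumes x: "x \<in> feasible" and y: "y \<in> feasible"
    and min: "\<And>s. 0 < s \<Longrightarrow> s < 1 \<Longrightarrow> objective x \<le> objective (x + s *\<^sub>R (y - x))"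
  shows "0 \<le> slope x (y - x) + (l1 y - l1 x)"
proof (rule tendsto_lowerbound)
  show "((\<lambda>s. slope (x + s *\<^sub>R (y - x)) (y - x) + (l1 y - l1 x))
      \<longlongrightarrow> slope x (y - x) + (l1 y - l1 x)) (at_right 0)"
  proof -
    have "((\<lambda>s. slope (x + s *\<^sub>R (y - x)) (y - x) + (l1 y - l1 x))
      \<longlongrightarrow> slope (x + 0 *\<^sub>R (y - x)) (y - x) + (l1 y - l1 x)) (at_right 0)"
      unfolding slope_def using x
      by (intro tendsto_intros tendsto) (auto simp: feasible_def)
    then show ?thesis by simp
  qed
  have "0 \<le> slope (x + s *\<^sub>R (y - x)) (y - x) + (l1 y - l1 x)" if s: "s \<in> {0<..<1}" for s
  proof -
    let ?z = "x + s *\<^sub>R (y - x)"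
    have "?z $ d = (1 - s) * x $ d + s * y $ d" for d
      by (simp add: algebra_simps)
    then have "?z \<in> feasible"
      using x y s by (auto simp: feasible_def intro!: add_pos_pos)
    then have "objective ?z + slope ?z (x - ?z) + (l1 x - l1 ?z) \<le> objective x"
      using objective_lower[of ?z x] x nonneg[of "x - ?z"] barrier_dist_nonneg[of ?z x] by linarith
    moreover have "x - ?z = (- s) *\<^sub>R (y - x)"
      by simp
    ultimately have "objective ?z - s * slope ?z (y - x) + (l1 x - l1 ?z) \<le> objective x"
      using slope_scale[of ?z "- s" "y - x"] by simp
    then have "0 \<le> s * (slope ?z (y - x) + (l1 y - l1 x))"
      using min[of s] l1_convex[of s x y] s by (auto simp: algebra_simps)
    then show ?thesis
      using s by (simp add: zero_le_mult_iff)
  qed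
  then show "\<forall>\<^sub>F s in at_right 0. 0 \<le> slope (x + s *\<^sub>R (y - x)) (y - x) + (l1 y - l1 x)"
    by (intro eventually_at_rightI[of 0 1]) simp_all
qed simp

lemma continuous_on_l1: "continuous_on A l1"
  unfolding l1_def by (intro continuous_intros)

text \<open>The sum vanishes at no unit vector: a zero of the penalty is supported on \<open>D\<close>, where \<open>B\<close> is
  definite. Its positive minimum on the unit sphere gives linear growth, since for \<open>\<parallel>x\<parallel> \<ge> 1\<close> the
  quadratic part grows even faster than linearly.\<close>

lemma quadratic_l1_coercive: "\<exists>e>0. \<forall>x. e * norm x - e \<le> 1/2 * B x x + l1 x"
proof -
  have ne: "sphere (0::real^'c) 1 \<noteq> {}" by simp
  have cont: "continuous_on (sphere 0 1) (\<lambda>x. 1/2 * B x x + l1 x)"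
    by (intro continuous_intros continuous_on_quad continuous_on_l1)
  obtain u where u: "u \<in> sphere 0 1"
    "\<And>x. x \<in> sphere 0 1 \<Longrightarrow> 1/2 * B u u + l1 u \<le> 1/2 * B x x + l1 x"
    using continuous_attains_inf[OF compact_sphere ne cont] by auto
  define e where "e = 1/2 * B u u + l1 u"
  have "e \<noteq> 0"
  proof
    assume "e = 0"
    then have z: "B u u = 0" "l1 u = 0"
      using nonneg[of u] l1_nonneg[of u] by (auto simp: e_def)
    have w: "weight c * \<bar>u $ c\<bar> = 0" for c
      using z(2) by (simp add: l1_def sum_nonneg_eq_0_iff weight_nonneg)
    then have "u $ c = 0" if "c \<notin> D" for c
      using w[of c] that lam_pos by (simp add: weight_def)
    then have "u = 0"
      using diag_definite z(1) by blast
    then show False using u(1) by simp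
  qed
  then have e: "e > 0"
    using nonneg[of u] l1_nonneg[of u] by (simp add: e_def)
  have "e * norm x - e \<le> 1/2 * B x x + l1 x" for x
  proof (cases "norm x \<le> 1")
    case True
    then have "e * norm x - e \<le> 0" using e by simp
    then show ?thesis using nonneg[of x] l1_nonneg[of x] by linarith
  next
    case False
    let ?t = "norm x"
    from False have x0: "x \<noteq> 0"
      by auto
    then have "(1 / ?t) *\<^sub>R x \<in> sphere 0 1"
      by simp
    from u(2)[OF this] have "e \<le> 1/2 * B ((1 / ?t) *\<^sub>R x) ((1 / ?t) *\<^sub>R x) + l1 ((1 / ?t) *\<^sub>R x)"
      by (simp only: e_def)
    also have "\<dots> = 1/2 * B x x / ?t\<^sup>2 + l1 x / ?t"
      using x0 by (simp add: scaleR_left scaleR_right l1_scale power2_eq_square)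
    finally have "e * ?t \<le> (1/2 * B x x / ?t\<^sup>2 + l1 x / ?t) * ?t"
      using False by (intro mult_right_mono) auto
    also have "\<dots> = (1/2 * B x x) / ?t + l1 x"
      using x0 by (simp add: field_simps power2_eq_square)
    also have "(1/2 * B x x) / ?t \<le> 1/2 * B x x"
      using False x0 nonneg[of x] mult_left_mono[of 1 ?t "B x x"] by (simp add: field_simps)
    finally show ?thesis using e by simp
  qed
  with e show ?thesis by blast
qed

text \<open>The logarithm grows more slowly than the linear lower bound of the other two terms, which bounds
  the norm. Then all logarithms are bounded above, so none can be very negative either.\<close>

lemma sublevel_bounds:
  "\<exists>M d. 0 < M \<and> 0 < d \<and> (\<forall>x\<in>feasible. objective x \<le> a \<longrightarrow> norm x \<le> M \<and> (\<forall>c\<in>D. d \<le> x $ c))"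
proof -
  obtain e where e: "e > 0" "\<And>x. e * norm x - e \<le> 1/2 * B x x + l1 x"
    using quadratic_l1_coercive by blast
  define k where "k = real (card D)"
  \<comment> \<open>The slope \<open>h\<close> in \<open>ln t \<le> h t - ln h\<close> is small enough that the barrier uses up at most half of
    the coercivity constant \<open>e\<close>.\<close>
  define h where "h = e / (2 * (k + 1))"
  have k: "k \<ge> 0" by (simp add: k_def)
  have h: "h > 0" using e(1) k by (simp add: h_def)
  have kh: "k * h \<le> e / 2"
    using e(1) k by (simp add: h_def field_simps)
  define M where "M = max 1 ((a + e - k * ln h) / (e / 2))"
  define d where "d = exp (- (a + k * ln M))"
  have M: "M \<ge> 1" by (simp add: M_def)
  have "norm x \<le> M \<and> (\<forall>c\<in>D. d \<le> x $ c)" if x: "x \<in> feasible" "objective x \<le> a" for x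
  proof -
    have coord: "x $ c \<le> norm x" for c
      using component_le_norm_cart[of x c] by simp
    have "(\<Sum>c\<in>D. ln (x $ c)) \<le> (\<Sum>c\<in>D. h * norm x - ln h)"
    proof (rule sum_mono)
      fix c assume "c \<in> D"
      then have pos: "x $ c > 0" using x by (simp add: feasible_def)
      then have "ln h + ln (x $ c) = ln (h * x $ c)"
        using h by (simp add: ln_mult)
      also have "\<dots> \<le> h * x $ c"
        using pos h ln_le_minus_one[of "h * x $ c"] by simp
      also have "\<dots> \<le> h * norm x"
        using h coord by simp
      finally show "ln (x $ c) \<le> h * norm x - ln h" by simp
    qed
    also have "\<dots> = (k * h) * norm x - k * ln h"
      by (simp add: k_def algebra_simps)
    also have "\<dots> \<le> e / 2 * norm x - k * ln h"
      using mult_right_mono[OF kh, of "norm x"] by simp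
    finally have "e * norm x - e - (e / 2 * norm x - k * ln h) \<le> objective x"
      using e(2)[of x] by (simp add: objective_def sum_negf)
    then have "norm x * (e / 2) \<le> a + e - k * ln h"
      using x(2) by (simp add: algebra_simps)
    then have "norm x \<le> (a + e - k * ln h) / (e / 2)"
      using e(1) by (subst pos_le_divide_eq) auto
    then have norm: "norm x \<le> M" by (simp add: M_def)
    have "d \<le> x $ c" if c: "c \<in> D" for c
    proof -
      have pos: "x $ c' > 0" if "c' \<in> D" for c'
        using that x by (simp add: feasible_def)
      have "ln (x $ c') \<le> ln M" if "c' \<in> D" for c'
        using pos[OF that] coord[of c'] norm M by simp
      then have "(\<Sum>c'\<in>D - {c}. ln (x $ c')) \<le> real (card (D - {c})) * ln M"
        by (intro sum_bounded_above) auto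
      also have "\<dots> \<le> k * ln M"
        unfolding k_def using M by (intro mult_right_mono) (auto simp: card_Diff1_le)
      finally have "(\<Sum>c'\<in>D. ln (x $ c')) \<le> ln (x $ c) + k * ln M"
        using c by (simp add: sum.remove)
      moreover have "- (\<Sum>c'\<in>D. ln (x $ c')) \<le> objective x"
        using nonneg[of x] l1_nonneg[of x] by (simp add: objective_def sum_negf)
      ultimately have "- (a + k * ln M) \<le> ln (x $ c)"
        using x(2) by linarith
      then have "exp (- (a + k * ln M)) \<le> exp (ln (x $ c))"
        by (simp only: exp_le_cancel_iff)
      then show ?thesis using pos[OF c] by (simp add: d_def)
    qed
    with norm show ?thesis by blast
  qed
  moreover have "M > 0" "d > 0" using M by (auto simp: d_def)
  ultimately show ?thesis by blast
qed

text \<open>Stated for a closed set \<open>T\<close>, to cover the whole space as well as the coordinate lines.\<close>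

lemma attains_minimum:
  assumes T: "closed T" and x0: "x0 \<in> T" "x0 \<in> feasible"
  shows "\<exists>x\<in>T \<inter> feasible. \<forall>y\<in>T \<inter> feasible. objective x \<le> objective y"
proof -
  obtain M d where M: "0 < d" "\<And>x. x \<in> feasible \<Longrightarrow> objective x \<le> objective x0 \<Longrightarrow> norm x \<le> M \<and> (\<forall>c\<in>D. d \<le> x $ c)"
    using sublevel_bounds[of "objective x0"] by blast
  define K where "K = T \<inter> (cball 0 M \<inter> {x. \<forall>c\<in>D. d \<le> x $ c})"
  have "closed {x::real^'c. \<forall>c\<in>D. d \<le> x $ c}"
    unfolding Ball_def
    by (intro closed_Collect_all closed_Collect_imp open_Collect_const closed_Collect_le continuous_intros)
  then have "compact K"
    unfolding K_def using T by (intro closed_Int_compact compact_Int_closed) auto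
  moreover have in_K: "x \<in> K" if "x \<in> T \<inter> feasible" "objective x \<le> objective x0" for x
    using that M(2) by (auto simp: K_def)
  have "x0 \<in> K" using in_K x0 by simp
  moreover have K_feasible: "K \<subseteq> T \<inter> feasible"
    using M(1) by (force simp: K_def feasible_def)
  then have "continuous_on K objective"
    unfolding objective_def by (intro continuous_intros continuous_on_quad continuous_on_l1)
      (force simp: feasible_def)
  ultimately obtain x where x: "x \<in> K" "\<And>y. y \<in> K \<Longrightarrow> objective x \<le> objective y"
    using continuous_attains_inf[of K objective] by blast
  have "objective x \<le> objective y" if "y \<in> T \<inter> feasible" for y
    using x(2)[OF \<open>x0 \<in> K\<close>] x(2)[of y] in_K[OF that] by linarith
  then show ?thesis using x(1) K_feasible by blast
qed


section \<open>Coordinatewise optimality\<close>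

definition coord_optimal :: "'c \<Rightarrow> real^'c \<Rightarrow> bool" where
  "coord_optimal c u \<longleftrightarrow> u \<in> feasible \<and>
     (\<forall>y\<in>feasible. (\<forall>c'. c' \<noteq> c \<longrightarrow> y $ c' = u $ c') \<longrightarrow> objective u \<le> objective y)"

lemma differ_in_coord:
  assumes "\<forall>c'. c' \<noteq> c \<longrightarrow> y $ c' = x $ c'"
  shows "y - x = (y $ c - x $ c) *\<^sub>R axis c 1"
  using assms by (simp add: vec_eq_iff axis_def)

lemma l1_differ_in_coord:
  assumes "\<forall>c'. c' \<noteq> c \<longrightarrow> y $ c' = x $ c'"
  shows "l1 y - l1 x = weight c * (\<bar>y $ c\<bar> - \<bar>x $ c\<bar>)"
proof -
  have "l1 y - l1 x = (\<Sum>c'\<in>UNIV. if c' = c then weight c * (\<bar>y $ c\<bar> - \<bar>x $ c\<bar>) else 0)"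
    unfolding l1_def sum_subtractf[symmetric]
    using assms by (intro sum.cong) (auto simp: algebra_simps)
  then show ?thesis by simp
qed

lemma coordinate_variational:
  assumes u: "coord_optimal c u" and t: "c \<in> D \<Longrightarrow> t > 0"
  shows "0 \<le> (t - u $ c) * slope u (axis c 1) + weight c * (\<bar>t\<bar> - \<bar>u $ c\<bar>)"
proof -
  define y where "y = (\<chi> c'. if c' = c then t else u $ c')"
  have y: "\<forall>c'. c' \<noteq> c \<longrightarrow> y $ c' = u $ c'" "y $ c = t"
    by (simp_all add: y_def)
  have uf: "u \<in> feasible" using u by (simp add: coord_optimal_def)
  then have yf: "y \<in> feasible" using t by (auto simp: feasible_def y_def)
  have "0 \<le> slope u (y - u) + (l1 y - l1 u)"
  proof (rule variational_inequality[OF uf yf])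
    fix s :: real assume s: "0 < s" "s < 1"
    have eq: "(u + s *\<^sub>R (y - u)) $ d = (1 - s) * u $ d + s * y $ d" for d
      by (simp add: algebra_simps)
    have "u + s *\<^sub>R (y - u) \<in> feasible"
      using uf yf s unfolding feasible_def mem_Collect_eq eq by (auto intro!: add_pos_pos)
    moreover have "\<forall>c'. c' \<noteq> c \<longrightarrow> (u + s *\<^sub>R (y - u)) $ c' = u $ c'"
      using y by simp
    ultimately show "objective u \<le> objective (u + s *\<^sub>R (y - u))"
      using u unfolding coord_optimal_def by blast
  qed
  then show ?thesis
    by (simp add: differ_in_coord[OF y(1)] l1_differ_in_coord[OF y(1)] slope_scale y(2))
qed

text \<open>The first-order terms are nonnegative by optimality, and the quadratic form has positive
  curvature along the coordinate.\<close>

lemma coordinate_decrease: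
  assumes u: "coord_optimal c u" and y: "y \<in> feasible" "\<forall>c'. c' \<noteq> c \<longrightarrow> y $ c' = u $ c'"
  shows "1/2 * B (axis c 1) (axis c 1) * (norm (y - u))\<^sup>2 \<le> objective y - objective u"
proof -
  have "0 \<le> slope u (y - u) + (l1 y - l1 u)"
    using coordinate_variational[OF u, of "y $ c"] y
    by (simp add: differ_in_coord[OF y(2)] l1_differ_in_coord[OF y(2)] slope_scale feasible_def)
  moreover have "B (y - u) (y - u) = B (axis c 1) (axis c 1) * (norm (y - u))\<^sup>2"
    by (simp add: differ_in_coord[OF y(2)] scaleR_left scaleR_right power2_eq_square)
  ultimately show ?thesis
    using objective_lower[of u y] u y(1) barrier_dist_nonneg[of u y] by (simp add: coord_optimal_def)
qed

section \<open>The error bound\<close>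

text \<open>With \<open>s = sqrt (y\<^sub>d / x\<^sub>d)\<close> one has \<open>y\<^sub>d - x\<^sub>d = x\<^sub>d (s + 1) (s - 1)\<close>, and \<open>x\<^sub>d s\<close> is the
  geometric mean of \<open>x\<^sub>d\<close> and \<open>y\<^sub>d\<close>, hence at most \<open>M\<close>.\<close>

lemma barrier_dist_lower:
  assumes "\<And>d. d \<in> D \<Longrightarrow> 0 < x $ d \<and> x $ d \<le> M \<and> 0 < y $ d \<and> y $ d \<le> M"
  shows "(\<Sum>d\<in>D. (y $ d - x $ d)\<^sup>2) \<le> 4 * M\<^sup>2 * barrier_dist x y"
  unfolding barrier_dist_def sum_distrib_left
proof (rule sum_mono)
  fix d assume "d \<in> D"
  with assms have x: "0 < x $ d" "x $ d \<le> M" and y: "0 < y $ d" "y $ d \<le> M" by auto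
  let ?s = "sqrt (y $ d / x $ d)"
  have s: "?s\<^sup>2 = y $ d / x $ d" "?s \<ge> 0" using x y by simp_all
  have "(x $ d * ?s)\<^sup>2 = x $ d * y $ d"
    using x by (simp only: power_mult_distrib s) (simp add: power2_eq_square)
  also have "\<dots> \<le> M\<^sup>2"
    using x y by (simp add: power2_eq_square mult_mono)
  finally have "x $ d * ?s \<le> M"
    using x by (meson less_le_trans less_imp_le power2_le_imp_le)
  then have "x $ d * (?s + 1) \<le> 2 * M"
    using x by (simp add: algebra_simps)
  then have "(x $ d * (?s + 1))\<^sup>2 \<le> (2 * M)\<^sup>2"
    using x s by (intro power_mono) auto
  then have "(x $ d * (?s + 1))\<^sup>2 * (?s - 1)\<^sup>2 \<le> 4 * M\<^sup>2 * (?s - 1)\<^sup>2"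
    by (intro mult_right_mono) (auto simp: power_mult_distrib)
  moreover have "y $ d - x $ d = x $ d * (?s + 1) * (?s - 1)"
  proof -
    have "x $ d * (?s + 1) * (?s - 1) = x $ d * (?s\<^sup>2 - 1)"
      by (simp add: algebra_simps power2_eq_square)
    then show ?thesis using x by (simp only: s) (simp add: algebra_simps)
  qed
  ultimately show "(y $ d - x $ d)\<^sup>2 \<le> 4 * M\<^sup>2 * (?s - 1)\<^sup>2"
    by (simp only: power_mult_distrib)
qed

text \<open>Adding a vector on which this form vanishes changes neither the barrier nor the quadratic
  form, nor the gradient of either.\<close>

lemma psd_form_with_barrier: "psd_form (\<lambda>x y. B x y + (\<Sum>d\<in>D. x $ d * y $ d))"
proof -
  have "bounded_bilinear (\<lambda>x y. B x y + (\<Sum>d\<in>D. x $ d * y $ d))"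
    unfolding bilinear_conv_bounded_bilinear[symmetric]
    by (auto simp: bilinear_def add_left add_right scaleR_left scaleR_right sum.distrib
        sum_distrib_left algebra_simps intro!: linearI)
  then show ?thesis
    by (simp add: psd_form_def psd_form_axioms_def nonneg sum_nonneg sym mult.commute)
qed

text \<open>
  Let \<open>g\<close> be the gradient of the smooth part at the given minimizer and \<open>p\<^sub>c(t) = g\<^sub>c t + weight\<^sub>c \<bar>t\<bar>\<close>.
  Optimality makes every \<open>p\<^sub>c\<close> nonnegative, with value \<open>0\<close> at the minimizer.

  A minimizer near \<open>x\<close> is found in two moves. First, every coordinate of \<open>x\<close> that violates
  \<open>p\<^sub>c = 0\<close> is set to \<open>0\<close>, giving \<open>y\<close>; this costs at most the sum of the \<open>p\<^sub>c(x\<^sub>c)\<close> up to a factor,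
  because \<open>p\<^sub>c\<close> is linear on either half-line. Then \<open>y\<close> moves towards the given minimizer by the vector of
  \<open>conformal_bound\<close>. The zero set of \<open>p\<^sub>c\<close> is an interval, so this move keeps \<open>p\<^sub>c = 0\<close>, while the remaining
  difference to the given minimizer becomes a null vector.
\<close>

lemma error_bound:
  assumes xs: "xs \<in> feasible" and min: "\<And>y. y \<in> feasible \<Longrightarrow> objective xs \<le> objective y"
  shows "\<exists>C>0. \<forall>x\<in>feasible. objective x \<le> a \<longrightarrow>
           (\<exists>z\<in>feasible. objective z = objective xs \<and> (norm (x - z))\<^sup>2 \<le> C * (objective x - objective xs))"
proof -
  define R where "R = (\<lambda>x y. B x y + (\<Sum>d\<in>D. x $ d * y $ d))"
  interpret R: psd_form R
    unfolding R_def by (rule psd_form_with_barrier)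
  define g where "g c = slope xs (axis c 1)" for c
  define p where "p c t = g c * t + weight c * \<bar>t\<bar>" for c t
  have opt: "coord_optimal c xs" for c
    using xs min by (simp add: coord_optimal_def)
  have var: "0 \<le> (t - xs $ c) * g c + weight c * (\<bar>t\<bar> - \<bar>xs $ c\<bar>)" if "c \<in> D \<Longrightarrow> t > 0" for c t
    using coordinate_variational[OF opt that] by (simp add: g_def)
  have g_D: "g c = 0" if "c \<in> D" for c
  proof -
    have pos: "xs $ c > 0" using that xs by (simp add: feasible_def)
    then have "0 \<le> (xs $ c / 2 - xs $ c) * g c" "0 \<le> (2 * xs $ c - xs $ c) * g c"
      using var[of c "xs $ c / 2"] var[of c "2 * xs $ c"] that by (simp_all add: weight_def)
    then show ?thesis using pos by (auto simp: zero_le_mult_iff mult_le_0_iff)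
  qed
  have p_xs: "p c (xs $ c) = 0" for c
  proof (cases "c \<in> D")
    case False
    then show ?thesis
      using var[of c 0] var[of c "2 * xs $ c"] by (simp add: p_def algebra_simps abs_mult)
  qed (simp add: p_def g_D weight_def)
  have p_nonneg: "0 \<le> p c t" for c t
  proof (cases "c \<in> D")
    case False
    then show ?thesis
      using var[of c t] p_xs[of c] by (simp add: p_def algebra_simps)
  qed (simp add: p_def g_D weight_def)
  \<comment> \<open>The slopes of the functions \<open>p c\<close> on the two half-lines; a nonzero value of \<open>p c\<close> means that the slope there is
    positive, and \<open>e\<close> bounds all these slopes from below. Inserting \<open>1\<close> covers the case that none
    is positive.\<close>
  define S where "S = {s \<in> range (\<lambda>c. weight c + g c) \<union> range (\<lambda>c. weight c - g c). s > 0}"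
  define e where "e = Min (insert 1 S)"
  have S: "finite S" by (simp add: S_def)
  have e: "e > 0" using S by (auto simp: e_def S_def)
  have p_growth: "e * \<bar>t\<bar> \<le> p c t" if "p c t \<noteq> 0" for c t
  proof -
    define s where "s = (if t > 0 then weight c + g c else weight c - g c)"
    have eq: "p c t = s * \<bar>t\<bar>"
      by (auto simp: p_def s_def algebra_simps)
    then have "s * \<bar>t\<bar> > 0" using that p_nonneg[of c t] by linarith
    then have "s > 0" by (simp add: zero_less_mult_iff)
    then have "s \<in> S" by (auto simp: S_def s_def)
    then have "e \<le> s" using S by (simp add: e_def)
    then show ?thesis by (simp add: eq mult_right_mono)
  qed
  have p_between: "p c t = 0"
    if "p c r = 0" "min 0 (r - xs $ c) \<le> t - xs $ c" "t - xs $ c \<le> max 0 (r - xs $ c)" for c r t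
  proof -
    have cs: "t \<in> closed_segment (xs $ c) r"
      using that(2,3) by (auto simp: closed_segment_eq_real_ivl min_def max_def split: if_splits)
    then obtain l where l: "0 \<le> l" "l \<le> 1" "t = (1 - l) * xs $ c + l * r"
      by (auto simp: closed_segment_def)
    have "\<bar>t\<bar> \<le> (1 - l) * \<bar>xs $ c\<bar> + l * \<bar>r\<bar>"
      unfolding l(3) using l by (intro order_trans[OF abs_triangle_ineq]) (simp add: abs_mult)
    then have "weight c * \<bar>t\<bar> \<le> weight c * ((1 - l) * \<bar>xs $ c\<bar> + l * \<bar>r\<bar>)"
      by (intro mult_left_mono weight_nonneg)
    then have "p c t \<le> (1 - l) * p c (xs $ c) + l * p c r"
      unfolding p_def l(3) by (simp add: algebra_simps)
    then show ?thesis using p_nonneg[of c t] that(1) p_xs by simp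
  qed
  \<comment> \<open>Everything that the convexity inequality at \<open>xs\<close> has to first order.\<close>
  have slope_p: "slope xs (x - xs) + (l1 x - l1 xs) = (\<Sum>c\<in>UNIV. p c (x $ c))" for x
  proof -
    have "slope xs (x - xs) + (l1 x - l1 xs) = (\<Sum>c\<in>UNIV. p c (x $ c) - p c (xs $ c))"
      unfolding slope_coords[of xs "x - xs"] l1_def sum_subtractf[symmetric] sum.distrib[symmetric]
      by (rule sum.cong) (auto simp: p_def g_def algebra_simps)
    then show ?thesis by (simp add: p_xs)
  qed
  obtain k where k: "k > 0"
    "\<And>w. \<exists>v. (\<forall>c. min 0 (w $ c) \<le> v $ c \<and> v $ c \<le> max 0 (w $ c))
       \<and> R (w - v) (w - v) = 0 \<and> k * (norm v)\<^sup>2 \<le> R w w"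
    using R.conformal_bound by blast
  obtain L where L: "L > 0" "\<And>x y. \<bar>R x y\<bar> \<le> L * norm x * norm y"
    using R.quad_le_norm by blast
  obtain M where M: "M > 0" "\<And>x. x \<in> feasible \<Longrightarrow> objective x \<le> max a (objective xs) \<Longrightarrow> norm x \<le> M"
    using sublevel_bounds[of "max a (objective xs)"] by blast
  \<comment> \<open>On the sublevel set the gap is at most \<open>A\<close>, so a quantity bounded by the gap has a square bounded
    by \<open>A\<close> times the gap.\<close>
  define A where "A = max 1 (a - objective xs)"
  have A: "A > 0" by (simp add: A_def)
  define C where "C = 2 * (A / e\<^sup>2) + 2 * ((2 * (2 + 4 * M\<^sup>2) + 2 * (L * (A / e\<^sup>2))) / k)"
  have "C > 0" using A k L e by (auto simp: C_def intro!: add_pos_nonneg)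
  moreover have "\<exists>z\<in>feasible. objective z = objective xs \<and> (norm (x - z))\<^sup>2 \<le> C * (objective x - objective xs)"
    if x: "x \<in> feasible" "objective x \<le> a" for x
  proof -
    define f where "f = objective x - objective xs"
    define P where "P = (\<Sum>c\<in>UNIV. p c (x $ c))"
    define y where "y = (\<chi> c. if p c (x $ c) = 0 then x $ c else 0)"
    have p_y: "p c (y $ c) = 0" for c
      by (simp add: y_def p_def)
    obtain v where v: "\<And>c. min 0 ((y - xs) $ c) \<le> v $ c \<and> v $ c \<le> max 0 ((y - xs) $ c)"
      "R (y - xs - v) (y - xs - v) = 0" "k * (norm v)\<^sup>2 \<le> R (y - xs) (y - xs)"
      using k(2)[of "y - xs"] by blast
    define z where "z = y - v"
    have z: "z - xs = y - xs - v" "x - z = (x - y) + v"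
      by (simp_all add: z_def)
    have null: "B (z - xs) (z - xs) = 0" "\<And>d. d \<in> D \<Longrightarrow> z $ d = xs $ d"
    proof -
      have "B (z - xs) (z - xs) + (\<Sum>d\<in>D. (z - xs) $ d * (z - xs) $ d) = 0"
        using v(2) by (simp only: z(1) R_def)
      moreover have "0 \<le> (\<Sum>d\<in>D. (z - xs) $ d * (z - xs) $ d)"
        by (simp add: sum_nonneg)
      ultimately have *: "B (z - xs) (z - xs) = 0" "(\<Sum>d\<in>D. (z - xs) $ d * (z - xs) $ d) = 0"
        using nonneg[of "z - xs"] by linarith+
      then show "B (z - xs) (z - xs) = 0" by simp
      show "z $ d = xs $ d" if "d \<in> D" for d
        using *(2) that by (simp add: sum_nonneg_eq_0_iff)
    qed
    have zf: "z \<in> feasible"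
      using xs null(2) by (simp add: feasible_def)
    have p_z: "p c (z $ c) = 0" for c
      by (rule p_between[OF p_y[of c]]) (use v(1)[of c] in \<open>auto simp: z_def min_def max_def split: if_splits\<close>)
    have "objective z = objective xs"
    proof -
      have "B z z = B xs xs"
        using quad_add[of xs "z - xs"] null(1) null_orthogonal[OF null(1), of xs] by (simp add: sym)
      moreover have "slope xs (z - xs) = 0"
        using null null_orthogonal[OF null(1), of xs] by (simp add: slope_def sym[of xs])
      then have "l1 z = l1 xs"
        using slope_p[of z] by (simp add: p_z)
      ultimately show ?thesis
        by (simp add: objective_def null(2))
    qed
    have f: "P + 1/2 * B (x - xs) (x - xs) + barrier_dist xs x \<le> f"
      using objective_lower[OF xs x(1)] slope_p[of x] by (simp add: f_def P_def)
    have P: "0 \<le> P" by (simp add: P_def sum_nonneg p_nonneg)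
    have f_bounds: "P \<le> f" "0 \<le> f" "B (x - xs) (x - xs) \<le> 2 * f" "barrier_dist xs x \<le> f"
      using f P nonneg[of "x - xs"] barrier_dist_nonneg[of xs x] by auto
    have "f \<le> A" using x(2) by (simp add: f_def A_def)
    have "P\<^sup>2 \<le> f * f"
      using P f_bounds by (simp add: power2_eq_square mult_mono)
    also have "\<dots> \<le> A * f"
      using \<open>f \<le> A\<close> f_bounds(2) by (rule mult_right_mono)
    finally have P2: "P\<^sup>2 \<le> A * f" .
    have "norm (x - y) \<le> (\<Sum>c\<in>UNIV. \<bar>(x - y) $ c\<bar>)"
      by (rule norm_le_l1_cart)
    also have "\<dots> \<le> (\<Sum>c\<in>UNIV. p c (x $ c) / e)"
    proof (rule sum_mono)
      fix c show "\<bar>(x - y) $ c\<bar> \<le> p c (x $ c) / e"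
        using p_growth[of c "x $ c"] e by (auto simp: y_def field_simps)
    qed
    also have "\<dots> = P / e" by (simp add: P_def sum_divide_distrib)
    finally have "(norm (x - y))\<^sup>2 \<le> (P / e)\<^sup>2"
      by (intro power_mono) auto
    also have "\<dots> \<le> A / e\<^sup>2 * f"
      using P2 e by (simp add: power_divide field_simps)
    finally have xy: "(norm (x - y))\<^sup>2 \<le> A / e\<^sup>2 * f" .
    have "R (x - xs) (x - xs) \<le> (2 + 4 * M\<^sup>2) * f"
    proof -
      have "(\<Sum>d\<in>D. (x $ d - xs $ d)\<^sup>2) \<le> 4 * M\<^sup>2 * barrier_dist xs x"
      proof (rule barrier_dist_lower)
        fix d assume "d \<in> D"
        moreover have "norm x \<le> M" "norm xs \<le> M"
          using M(2) x xs by auto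
        ultimately show "0 < xs $ d \<and> xs $ d \<le> M \<and> 0 < x $ d \<and> x $ d \<le> M"
          using x xs component_le_norm_cart[of x d]
            component_le_norm_cart[of xs d] by (auto simp: feasible_def)
      qed
      also have "\<dots> \<le> 4 * M\<^sup>2 * f"
        using f_bounds(4) by (intro mult_left_mono) auto
      finally show ?thesis
        using f_bounds(3) by (simp add: R_def power2_eq_square algebra_simps)
    qed
    moreover have "R (x - y) (x - y) \<le> L * (A / e\<^sup>2) * f"
    proof -
      have "R (x - y) (x - y) \<le> L * (norm (x - y))\<^sup>2"
        using L(2)[of "x - y" "x - y"] unfolding power2_eq_square mult.assoc by (rule order_trans[OF abs_ge_self])
      also have "\<dots> \<le> L * (A / e\<^sup>2 * f)"
        using xy L(1) by (intro mult_left_mono) auto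
      finally show ?thesis by (simp only: mult.assoc)
    qed
    moreover have "R (y - xs) (y - xs) \<le> 2 * R (x - xs) (x - xs) + 2 * R (x - y) (x - y)"
    proof -
      have "(x - xs) - (x - y) = y - xs" by simp
      then show ?thesis
        using R.quad_diff_le[of "x - xs" "x - y"] by (simp only:)
    qed
    ultimately have "R (y - xs) (y - xs) \<le> 2 * ((2 + 4 * M\<^sup>2) * f) + 2 * (L * (A / e\<^sup>2) * f)"
      by linarith
    with v(3) have "k * (norm v)\<^sup>2 \<le> (2 * (2 + 4 * M\<^sup>2) + 2 * (L * (A / e\<^sup>2))) * f"
      by (simp only: distrib_right mult.assoc)
    then have v_le: "(norm v)\<^sup>2 \<le> (2 * (2 + 4 * M\<^sup>2) + 2 * (L * (A / e\<^sup>2))) / k * f"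
      using k(1) by (simp add: pos_le_divide_eq mult.commute)
    have "(norm (x - z))\<^sup>2 \<le> (norm (x - y) + norm v)\<^sup>2"
      unfolding z(2) by (intro power_mono norm_triangle_ineq) simp
    also have "\<dots> \<le> 2 * (norm (x - y))\<^sup>2 + 2 * (norm v)\<^sup>2"
      using sum_squares_ge_zero[of "norm (x - y) - norm v" 0] by (simp add: power2_eq_square algebra_simps)
    also have "\<dots> \<le> 2 * (A / e\<^sup>2 * f) + 2 * ((2 * (2 + 4 * M\<^sup>2) + 2 * (L * (A / e\<^sup>2))) / k * f)"
      using xy v_le by linarith
    also have "\<dots> = C * f"
      unfolding C_def distrib_right mult.assoc ..
    finally show ?thesis
      using zf \<open>objective z = objective xs\<close> by (auto simp: f_def)
  qed
  ultimately show ?thesis by blast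
qed


section \<open>Cyclic coordinate descent\<close>

lemma ex1_coord_optimal:
  assumes x: "x \<in> feasible"
  shows "\<exists>!u. coord_optimal c u \<and> (\<forall>c'. c' \<noteq> c \<longrightarrow> u $ c' = x $ c')"
proof (rule ex_ex1I)
  define T where "T = {u::real^'c. \<forall>c'. c' \<noteq> c \<longrightarrow> u $ c' = x $ c'}"
  have "closed T"
    unfolding T_def
    by (intro closed_Collect_all closed_Collect_imp open_Collect_const closed_Collect_eq continuous_intros)
  moreover have "x \<in> T" by (simp add: T_def)
  ultimately obtain u where u: "u \<in> T \<inter> feasible" "\<forall>y\<in>T \<inter> feasible. objective u \<le> objective y"
    using attains_minimum x by blast
  then have "coord_optimal c u"
    unfolding coord_optimal_def T_def by simp
  then show "\<exists>u. coord_optimal c u \<and> (\<forall>c'. c' \<noteq> c \<longrightarrow> u $ c' = x $ c')"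
    using u(1) by (auto simp: T_def)
next
  fix u v
  assume u: "coord_optimal c u \<and> (\<forall>c'. c' \<noteq> c \<longrightarrow> u $ c' = x $ c')"
    and v: "coord_optimal c v \<and> (\<forall>c'. c' \<noteq> c \<longrightarrow> v $ c' = x $ c')"
  then have f: "u \<in> feasible" "v \<in> feasible"
    by (auto simp: coord_optimal_def)
  have "1/2 * B (axis c 1) (axis c 1) * (norm (v - u))\<^sup>2 \<le> objective v - objective u"
    using u v f by (intro coordinate_decrease) auto
  also have "objective v \<le> objective u"
    using u v f by (auto simp: coord_optimal_def)
  finally have "B (axis c 1) (axis c 1) * (norm (v - u))\<^sup>2 \<le> 0"
    by simp
  then show "u = v"
    using coord_pos[of c] by (simp add: mult_le_0_iff)
qed

definition update :: "'c \<Rightarrow> real^'c \<Rightarrow> real^'c" where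
  "update c x = (THE u. coord_optimal c u \<and> (\<forall>c'. c' \<noteq> c \<longrightarrow> u $ c' = x $ c'))"

lemma update:
  assumes "x \<in> feasible"
  shows "coord_optimal c (update c x)" "\<And>c'. c' \<noteq> c \<Longrightarrow> update c x $ c' = x $ c'"
    "update c x \<in> feasible"
  using theI'[OF ex1_coord_optimal[OF assms, of c]] unfolding update_def[symmetric]
  by (auto simp: coord_optimal_def)

text \<open>In a pass each coordinate changes at most once, so the single steps are orthogonal and their
  squared lengths add up. For the same reason the point reached right after the update of \<open>c\<close> is at
  most as far from the end of the pass as the start is, and shares the coordinate \<open>c\<close> with the end.\<close>

lemma fold_update:
  assumes "distinct cs" "x \<in> feasible"
    and m: "\<And>c. m \<le> 1/2 * B (axis c 1) (axis c 1)"
    and y: "y = fold update cs x"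
  shows "y \<in> feasible" "\<And>c. c \<notin> set cs \<Longrightarrow> y $ c = x $ c"
    and "m * (norm (y - x))\<^sup>2 \<le> objective x - objective y"
    and "\<And>c. c \<in> set cs \<Longrightarrow> \<exists>u. coord_optimal c u \<and> u $ c = y $ c \<and> norm (y - u) \<le> norm (y - x)"
proof -
  have "y \<in> feasible \<and> (\<forall>c. c \<notin> set cs \<longrightarrow> y $ c = x $ c)
    \<and> m * (norm (y - x))\<^sup>2 \<le> objective x - objective y
    \<and> (\<forall>c\<in>set cs. \<exists>u. coord_optimal c u \<and> u $ c = y $ c \<and> norm (y - u) \<le> norm (y - x))"
    using assms(1,2) y
  proof (induction cs arbitrary: x)
    case Nil
    then show ?case by simp
  next
    case (Cons a cs)
    define x1 where "x1 = update a x"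
    note x1 = update[where c = a, OF Cons.prems(2), folded x1_def]
    from Cons.IH[of x1] Cons.prems x1(3)
    have y: "y \<in> feasible" "\<And>c. c \<notin> set cs \<Longrightarrow> y $ c = x1 $ c"
      and dec: "m * (norm (y - x1))\<^sup>2 \<le> objective x1 - objective y"
      and opt: "\<forall>c\<in>set cs. \<exists>u. coord_optimal c u \<and> u $ c = y $ c \<and> norm (y - u) \<le> norm (y - x1)"
      by (auto simp: x1_def)
    have "(y - x1) $ c * (x1 - x) $ c = 0" for c
      using y(2)[of c] x1(2)[of c] Cons.prems(1) by (cases "c = a") auto
    then have "orthogonal (y - x1) (x1 - x)"
      unfolding orthogonal_def inner_vec_def by (intro sum.neutral) simp
    from norm_add_Pythagorean[OF this]
    have pyth: "(norm (y - x))\<^sup>2 = (norm (y - x1))\<^sup>2 + (norm (x1 - x))\<^sup>2"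
      by simp
    then have "(norm (y - x1))\<^sup>2 \<le> (norm (y - x))\<^sup>2"
      by simp
    then have le: "norm (y - x1) \<le> norm (y - x)"
      by (rule power2_le_imp_le) simp
    have "1/2 * B (axis a 1) (axis a 1) * (norm (x - x1))\<^sup>2 \<le> objective x - objective x1"
      by (rule coordinate_decrease) (use x1 Cons.prems(2) in auto)
    moreover have "m * (norm (x - x1))\<^sup>2 \<le> 1/2 * B (axis a 1) (axis a 1) * (norm (x - x1))\<^sup>2"
      by (intro mult_right_mono m) simp
    ultimately have "m * (norm (y - x))\<^sup>2 \<le> objective x - objective y"
      unfolding pyth distrib_left using dec by (simp add: norm_minus_commute)
    moreover have "\<forall>c. c \<notin> set (a # cs) \<longrightarrow> y $ c = x $ c"
      using y(2) x1(2) by simp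
    moreover have "y $ a = x1 $ a"
      using y(2) Cons.prems(1) by simp
    then have "\<forall>c\<in>set (a # cs). \<exists>u. coord_optimal c u \<and> u $ c = y $ c \<and> norm (y - u) \<le> norm (y - x)"
      using opt x1(1) le by (metis order_trans set_ConsD)
    ultimately show ?case using y(1) by blast
  qed
  then show "y \<in> feasible" "\<And>c. c \<notin> set cs \<Longrightarrow> y $ c = x $ c"
    "m * (norm (y - x))\<^sup>2 \<le> objective x - objective y"
    "\<And>c. c \<in> set cs \<Longrightarrow> \<exists>u. coord_optimal c u \<and> u $ c = y $ c \<and> norm (y - u) \<le> norm (y - x)"
    by blast+
qed

text \<open>In each coordinate compare the slope at \<open>y\<close> with the slope at the point \<open>u\<close> that was optimal. As
  \<open>u\<close> and \<open>y\<close> share the coordinate, the barrier cancels in the difference, which is the value of the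
  quadratic form at \<open>y - u\<close> and thus of order \<open>r\<close>.\<close>

lemma gap_le_pass_length:
  assumes K: "K > 0" "\<And>x y. \<bar>B x y\<bar> \<le> K * norm x * norm y"
    and y: "y \<in> feasible" and z: "z \<in> feasible"
    and opt: "\<And>c. \<exists>u. coord_optimal c u \<and> u $ c = y $ c \<and> norm (y - u) \<le> r"
  shows "objective y - objective z \<le> real CARD('c) * K * r * norm (y - z)"
proof -
  have "- (K * r * norm (y - z)) \<le>
      (z - y) $ c * slope y (axis c 1) + (weight c * \<bar>z $ c\<bar> - weight c * \<bar>y $ c\<bar>)" for c
  proof -
    obtain u where u: "coord_optimal c u" "u $ c = y $ c" "norm (y - u) \<le> r"
      using opt by blast
    have "0 \<le> (z $ c - u $ c) * slope u (axis c 1) + weight c * (\<bar>z $ c\<bar> - \<bar>u $ c\<bar>)"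
      using z by (intro coordinate_variational[OF u(1)]) (simp add: feasible_def)
    moreover have "slope y (axis c 1) - slope u (axis c 1) = B (y - u) (axis c 1)"
      by (simp add: slope_axis u(2) diff_left)
    moreover have "\<bar>(z - y) $ c * B (y - u) (axis c 1)\<bar> \<le> K * r * norm (y - z)"
    proof -
      have "\<bar>(z - y) $ c\<bar> \<le> norm (y - z)"
        using component_le_norm_cart[of "z - y" c] by (simp add: norm_minus_commute)
      moreover have "\<bar>B (y - u) (axis c 1)\<bar> \<le> K * norm (y - u)"
        using K(2)[of "y - u" "axis c 1"] by simp
      then have "\<bar>B (y - u) (axis c 1)\<bar> \<le> K * r"
        by (rule order_trans) (use u(3) K(1) in simp)
      ultimately have "\<bar>(z - y) $ c\<bar> * \<bar>B (y - u) (axis c 1)\<bar> \<le> norm (y - z) * (K * r)"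
        by (intro mult_mono) auto
      then show ?thesis by (simp add: abs_mult mult_ac)
    qed
    moreover have "(z - y) $ c * slope y (axis c 1)
        = (z $ c - u $ c) * slope u (axis c 1) + (z - y) $ c * (slope y (axis c 1) - slope u (axis c 1))"
      by (simp add: u(2) algebra_simps)
    ultimately show ?thesis
      by (simp add: u(2) algebra_simps abs_le_iff)
  qed
  then have "(\<Sum>c\<in>(UNIV::'c set). - (K * r * norm (y - z))) \<le> slope y (z - y) + (l1 z - l1 y)"
    unfolding slope_coords[of y "z - y"] l1_def sum_subtractf[symmetric] sum.distrib[symmetric]
    by (rule sum_mono)
  then show ?thesis
    using objective_lower[OF y z] nonneg[of "z - y"] barrier_dist_nonneg[of y z] by (simp add: mult.assoc)
qed

theorem cyclic_descent_convergent:
  assumes cs: "distinct cs" "set cs = UNIV" and x0: "x0 \<in> feasible"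
  shows "convergent (\<lambda>r. (fold update cs ^^ r) x0)"
proof -
  define X where "X r = (fold update cs ^^ r) x0" for r
  have X_Suc: "X (Suc r) = fold update cs (X r)" for r
    by (simp add: X_def)
  define m where "m = Min (range (\<lambda>c. 1/2 * B (axis c 1) (axis c 1)))"
  have m: "m > 0" "\<And>c. m \<le> 1/2 * B (axis c 1) (axis c 1)"
    using coord_pos by (simp add: m_def) (unfold m_def, rule Min_le, auto)
  have X_feasible: "X r \<in> feasible" for r
  proof (induction r)
    case (Suc r)
    then show ?case using fold_update(1)[OF cs(1) _ m(2) X_Suc] by blast
  qed (simp add: X_def x0)
  have dec: "m * (norm (X (Suc r) - X r))\<^sup>2 \<le> objective (X r) - objective (X (Suc r))" for r
    by (rule fold_update(3)[OF cs(1) X_feasible m(2) X_Suc])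
  have opt: "\<exists>u. coord_optimal c u \<and> u $ c = X (Suc r) $ c
      \<and> norm (X (Suc r) - u) \<le> norm (X (Suc r) - X r)" for r c
    using fold_update(4)[OF cs(1) X_feasible m(2) X_Suc] cs(2) by blast
  obtain xs where xs: "xs \<in> feasible" "\<And>y. y \<in> feasible \<Longrightarrow> objective xs \<le> objective y"
    using attains_minimum[of UNIV x0] x0 by auto
  obtain C where C: "C > 0" "\<And>x. x \<in> feasible \<Longrightarrow> objective x \<le> objective x0 \<Longrightarrow>
      \<exists>z\<in>feasible. objective z = objective xs \<and> (norm (x - z))\<^sup>2 \<le> C * (objective x - objective xs)"
    using error_bound[OF xs] by blast
  obtain K where K: "K > 0" "\<And>x y. \<bar>B x y\<bar> \<le> K * norm x * norm y"
    using quad_le_norm by blast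
  define gap where "gap r = objective (X r) - objective xs" for r
  have gap_nonneg: "0 \<le> gap r" for r
    using xs(2)[OF X_feasible] by (simp add: gap_def)
  have step_le: "m * (norm (X (Suc r) - X r))\<^sup>2 \<le> gap r - gap (Suc r)" for r
    using dec[of r] by (simp add: gap_def)
  have "gap (Suc r) \<le> gap r" for r
  proof -
    have "0 \<le> m * (norm (X (Suc r) - X r))\<^sup>2" using m(1) by simp
    then show ?thesis using step_le[of r] by linarith
  qed
  then have "gap r \<le> gap 0" for r
    by (rule lift_Suc_antimono_le) simp
  then have objective_le: "objective (X r) \<le> objective x0" for r
    by (simp add: gap_def X_def)
  \<comment> \<open>Squaring \<open>gap_le_pass_length\<close> and inserting the error bound gives
    \<open>gap (Suc r) \<le> L * (gap r - gap (Suc r))\<close>.\<close>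
  define L where "L = (real CARD('c) * K)\<^sup>2 * C / m"
  have L: "L > 0" using K(1) C(1) m(1) by (simp add: L_def)
  have contraction: "gap (Suc r) \<le> L / (1 + L) * gap r" for r
  proof -
    let ?d = "norm (X (Suc r) - X r)"
    obtain z where z: "z \<in> feasible" "objective z = objective xs" "(norm (X (Suc r) - z))\<^sup>2 \<le> C * gap (Suc r)"
      using C(2)[OF X_feasible objective_le, of "Suc r"] by (auto simp: gap_def)
    have "gap (Suc r) \<le> real CARD('c) * K * ?d * norm (X (Suc r) - z)"
      using gap_le_pass_length[OF K X_feasible z(1) opt] z(2) by (simp add: gap_def)
    then have "(gap (Suc r))\<^sup>2 \<le> (real CARD('c) * K * ?d * norm (X (Suc r) - z))\<^sup>2"
      using gap_nonneg by (intro power_mono)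
    also have "\<dots> = (real CARD('c) * K)\<^sup>2 * ?d\<^sup>2 * (norm (X (Suc r) - z))\<^sup>2"
      by (simp only: power_mult_distrib)
    also have "\<dots> \<le> (real CARD('c) * K)\<^sup>2 * ?d\<^sup>2 * (C * gap (Suc r))"
      using z(3) by (intro mult_left_mono) auto
    also have "\<dots> = (L * (m * ?d\<^sup>2)) * gap (Suc r)"
      using m(1) by (simp add: L_def)
    finally have "gap (Suc r) * gap (Suc r) \<le> (L * (m * ?d\<^sup>2)) * gap (Suc r)"
      by (simp only: power2_eq_square)
    moreover have "0 \<le> L * (m * ?d\<^sup>2)" using L m(1) by simp
    ultimately have "gap (Suc r) \<le> L * (m * ?d\<^sup>2)"
      using gap_nonneg[of "Suc r"] by (cases "gap (Suc r) = 0") auto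
    also have "\<dots> \<le> L * (gap r - gap (Suc r))"
      using step_le L by (intro mult_left_mono) auto
    finally show ?thesis using L by (simp add: field_simps)
  qed
  define q where "q = sqrt (L / (1 + L))"
  have q: "0 \<le> q" "q < 1" "q\<^sup>2 = L / (1 + L)"
    using L by (auto simp: q_def)
  have gap_le: "gap r \<le> gap 0 * (q ^ r)\<^sup>2" for r
  proof (induction r)
    case (Suc r)
    have "gap (Suc r) \<le> q\<^sup>2 * gap r" using contraction q(3) by simp
    also have "\<dots> \<le> q\<^sup>2 * (gap 0 * (q ^ r)\<^sup>2)" by (intro mult_left_mono Suc) simp
    finally show ?case by (simp add: power_mult_distrib mult_ac)
  qed simp
  have "norm (X (Suc r) - X r) \<le> sqrt (gap 0 / m) * q ^ r" for r
  proof (rule power2_le_imp_le)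
    have "m * (norm (X (Suc r) - X r))\<^sup>2 \<le> gap 0 * (q ^ r)\<^sup>2"
      using step_le[of r] gap_nonneg[of "Suc r"] gap_le[of r] by linarith
    then show "(norm (X (Suc r) - X r))\<^sup>2 \<le> (sqrt (gap 0 / m) * q ^ r)\<^sup>2"
      using m(1) gap_nonneg[of 0] by (simp add: power_mult_distrib field_simps)
    show "0 \<le> sqrt (gap 0 / m) * q ^ r"
      using m(1) gap_nonneg[of 0] q(1) by simp
  qed
  moreover have "summable (\<lambda>r. sqrt (gap 0 / m) * q ^ r)"
    using q by (intro summable_mult summable_geometric) simp
  ultimately have "summable (\<lambda>r. X (Suc r) - X r)"
    using summable_comparison_test[of "\<lambda>r. X (Suc r) - X r" "\<lambda>r. sqrt (gap 0 / m) * q ^ r"] by blast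
  then have "(\<lambda>n. X 0 + (\<Sum>r<n. X (Suc r) - X r)) \<longlonglongrightarrow> X 0 + (\<Sum>r. X (Suc r) - X r)"
    by (intro tendsto_add tendsto_const summable_LIMSEQ)
  then have "X \<longlonglongrightarrow> X 0 + (\<Sum>r. X (Suc r) - X r)"
    by (simp add: sum_lessThan_telescope)
  then show ?thesis
    unfolding X_def convergent_def by blast
qed

end

section \<open>Symmetric matrices as vectors of independent entries\<close>

text \<open>A separate index type makes the entries on and above the diagonal a full vector \<open>real ^ 'p coord\<close>,
  so that no coordinate is left out of a pass.\<close>

typedef (overloaded) ('p::"{finite,linorder}") coord = "coords :: ('p \<times> 'p) set"
  morphisms pair_of Coord
  by (auto simp: coords_def)

instance coord :: ("{finite,linorder}") finite
proof
  have "inj (pair_of :: 'a coord \<Rightarrow> _)"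
    by (simp add: inj_on_def pair_of_inject)
  then show "finite (UNIV :: 'a coord set)"
    using finite_imageD[of pair_of UNIV] by simp
qed

definition the_coord :: "'p \<Rightarrow> 'p \<Rightarrow> ('p::{finite,linorder}) coord" where
  "the_coord i j = Coord (min i j, max i j)"

definition mat_of :: "real ^ 'p coord \<Rightarrow> ('p::{finite,linorder}) sqmat" where
  "mat_of x = (\<chi> i j. x $ the_coord i j)"

definition coords_of :: "('p::{finite,linorder}) sqmat \<Rightarrow> real ^ 'p coord" where
  "coords_of W = (\<chi> c. W $ fst (pair_of c) $ snd (pair_of c))"

definition diag_coords :: "('p::{finite,linorder}) coord set" where
  "diag_coords = range (\<lambda>i. the_coord i i)"

definition quad_form :: "('p::{finite,linorder}) sqmat \<Rightarrow> real ^ 'p coord \<Rightarrow> real ^ 'p coord \<Rightarrow> real" where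
  "quad_form S x y = (\<Sum>i\<in>UNIV. column i (mat_of x) \<bullet> (S *v column i (mat_of y)))"

lemma pair_of_the_coord: "pair_of (the_coord i j) = (min i j, max i j)"
  unfolding the_coord_def by (rule Coord_inverse) (auto simp: coords_def min_def max_def)

lemma the_coord_pair_of: "the_coord (fst (pair_of c)) (snd (pair_of c)) = c"
  using pair_of[of c] pair_of_the_coord[of "fst (pair_of c)" "snd (pair_of c)"]
  by (auto simp: coords_def min_def max_def pair_of_inject[symmetric] split: if_splits)

lemma the_coord_eq_iff: "the_coord i j = c \<longleftrightarrow> (i, j) = pair_of c \<or> (j, i) = pair_of c"
  using pair_of[of c]
  by (auto simp: coords_def min_def max_def pair_of_inject[symmetric] pair_of_the_coord)

lemma the_coord_diag_eq: "the_coord i j = the_coord k k \<longleftrightarrow> i = k \<and> j = k"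
  by (auto simp: the_coord_eq_iff pair_of_the_coord)

lemma mat_of_nth [simp]: "mat_of x $ i $ j = x $ the_coord i j"
  by (simp add: mat_of_def)

lemma mat_of_coords_of:
  assumes "transpose W = W"
  shows "mat_of (coords_of W) = W"
proof -
  have sym: "W $ i $ j = W $ j $ i" for i j
    using assms by (metis transpose_def vec_lambda_beta)
  show ?thesis
    by (simp add: vec_eq_iff coords_of_def pair_of_the_coord min_def max_def) (use sym in blast)
qed

lemma set_coord_mat_of:
  "set_coord (mat_of x) (pair_of c) t = mat_of (\<chi> c'. if c' = c then t else x $ c')"
  by (auto simp: vec_eq_iff set_coord_def the_coord_eq_iff)

lemma mat_of_add: "mat_of (x + y) = mat_of x + mat_of y"
  and mat_of_scale: "mat_of (a *\<^sub>R x) = a *\<^sub>R mat_of x"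
  by (simp_all add: vec_eq_iff)

lemma column_add: "column i (A + B) = column i A + column i B"
  and column_scale: "column i (a *\<^sub>R A) = a *\<^sub>R column i (A :: real^'n^'m)"
  by (simp_all add: vec_eq_iff column_def)

lemma bounded_bilinear_quad_form: "bounded_bilinear (quad_form S)"
  unfolding bilinear_conv_bounded_bilinear[symmetric] quad_form_def
  by (auto simp: bilinear_def mat_of_add mat_of_scale column_add column_scale inner_add_left
      inner_add_right matrix_vector_right_distrib
      matrix_vector_mult_scaleR sum.distrib sum_distrib_left intro!: linearI)

lemma column_mat_of_axis:
  "column k (mat_of (axis (the_coord i j) 1)) =
     (if k = i then axis j 1 else if k = j then axis i 1 else (0::real^_))"
  by (auto simp: vec_eq_iff column_def axis_def the_coord_eq_iff pair_of_the_coord min_def max_def)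

lemma inner_axis_mult: "axis i 1 \<bullet> (S *v axis i 1) = (S $ i $ i :: real)"
  by (simp add: inner_axis' matrix_vector_mult_basis column_def)

text \<open>For a diagonal matrix the form is \<open>\<Sum>\<^sub>i x\<^sub>i\<^sub>i\<^sup>2 S\<^sub>i\<^sub>i\<close>, and a coordinate matrix has a column that is a
  unit vector; so the positive diagonal of \<open>S\<close> gives definiteness on the diagonal and positive
  curvature along every coordinate.\<close>

lemma log_l1_quadratic_concord:
  fixes S :: "('p::{finite,linorder}) sqmat"
  assumes "lam > 0" "psd_matrix S" and S_diag: "\<And>i. S $ i $ i > 0"
  shows "log_l1_quadratic (quad_form S) diag_coords lam"
proof -
  have S_sym: "transpose S = S" and S_nonneg: "\<And>x. 0 \<le> x \<bullet> (S *v x)"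
    using assms(2) by (auto simp: psd_matrix_def)
  interpret bounded_bilinear "quad_form S"
    by (rule bounded_bilinear_quad_form)
  show ?thesis
  proof unfold_locales
    show "quad_form S x y = quad_form S y x" for x y
      unfolding quad_form_def
      by (rule sum.cong) (metis S_sym dot_lmul_matrix inner_commute transpose_matrix_vector)+
    show "0 \<le> quad_form S x x" for x
      unfolding quad_form_def by (intro sum_nonneg S_nonneg)
    show "x = 0" if off: "\<And>c. c \<notin> diag_coords \<Longrightarrow> x $ c = 0" and null: "quad_form S x x = 0" for x
    proof -
      have "column i (mat_of x) = x $ the_coord i i *\<^sub>R axis i 1" for i
      proof -
        have "the_coord j i \<notin> diag_coords" if "j \<noteq> i" for j
          using that by (auto simp: diag_coords_def the_coord_diag_eq)
        then show ?thesis
          using off by (auto simp: vec_eq_iff column_def axis_def)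
      qed
      then have "quad_form S x x = (\<Sum>i\<in>UNIV. (x $ the_coord i i)\<^sup>2 * S $ i $ i)"
        by (simp add: quad_form_def matrix_vector_mult_scaleR inner_axis_mult power2_eq_square mult.assoc)
      then have "(\<Sum>i\<in>UNIV. (x $ the_coord i i)\<^sup>2 * S $ i $ i) = 0"
        using null by simp
      then have "(x $ the_coord i i)\<^sup>2 * S $ i $ i = 0" for i
        by (subst (asm) sum_nonneg_eq_0_iff) (auto simp: less_imp_le[OF S_diag])
      then have "x $ the_coord i i = 0" for i
        using S_diag[of i] by (metis less_irrefl mult_eq_0_iff zero_eq_power2)
      then show ?thesis
        using off by (auto simp: vec_eq_iff diag_coords_def image_iff) metis
    qed
    show "0 < quad_form S (axis c 1) (axis c 1)" for c
    proof -
      obtain i j where c: "c = the_coord i j"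
        using the_coord_pair_of by metis
      have "0 < axis j 1 \<bullet> (S *v axis j 1)"
        by (simp add: inner_axis_mult S_diag)
      also have "\<dots> = column i (mat_of (axis c 1)) \<bullet> (S *v column i (mat_of (axis c 1)))"
        by (simp add: c column_mat_of_axis)
      also have "\<dots> \<le> quad_form S (axis c 1) (axis c 1)"
        unfolding quad_form_def by (rule member_le_sum) (auto simp: S_nonneg)
      finally show ?thesis .
    qed
  qed (use assms in auto)
qed

lemma neg_log_eq:
  "(\<Sum>i\<in>A. neg_log (f i)) = (if \<forall>i\<in>A. f i > 0 then ereal (\<Sum>i\<in>A. - ln (f i)) else \<infinity>)"
  if "finite A"
  using that by (induction A) (auto simp: neg_log_def)

section \<open>The CONCORD iterates\<close>

context
  fixes S :: "('p::{finite,linorder}) sqmat" and lam :: real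
  assumes lam_pos: "lam > 0" and S_psd: "psd_matrix S" and S_diag: "\<And>i. S $ i $ i > 0"
begin

interpretation log_l1_quadratic "quad_form S" diag_coords lam
  by (rule log_l1_quadratic_concord[OF lam_pos S_psd S_diag])

lemma feasible_iff: "x \<in> feasible \<longleftrightarrow> (\<forall>i. mat_of x $ i $ i > 0)"
  unfolding feasible_def by (simp add: diag_coords_def)

lemma l1_eq: "l1 x = lam * (\<Sum>(i, j)\<in>{(i, j). i < j}. \<bar>mat_of x $ i $ j\<bar>)"
proof -
  have "l1 x = (\<Sum>c\<in>- diag_coords. lam * \<bar>x $ c\<bar>)"
    unfolding l1_def by (intro sum.mono_neutral_cong_right) (auto simp: weight_def)
  also have "\<dots> = (\<Sum>(i, j)\<in>{(i, j). i < j}. lam * \<bar>mat_of x $ i $ j\<bar>)"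
  proof (rule sum.reindex_bij_witness[of _ "\<lambda>(i, j). the_coord i j" pair_of])
    fix c :: "'p coord" assume c: "c \<in> - diag_coords"
    obtain i j where ij: "pair_of c = (i, j)" by force
    then have cij: "c = the_coord i j" "i \<le> j"
      using the_coord_pair_of[of c] pair_of[of c] by (auto simp: coords_def)
    then have "i \<noteq> j" using c by (auto simp: diag_coords_def)
    then show "pair_of c \<in> {(i, j). i < j}" using cij(2) by (simp add: ij)
    show "(case pair_of c of (i, j) \<Rightarrow> the_coord i j) = c"
      by (simp add: ij cij(1)[symmetric])
    show "(case pair_of c of (i, j) \<Rightarrow> lam * \<bar>mat_of x $ i $ j\<bar>) = lam * \<bar>x $ c\<bar>"
      by (simp add: ij cij(1)[symmetric])
  next
    fix p :: "'p \<times> 'p" assume p: "p \<in> {(i, j). i < j}"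
    then show "pair_of (case p of (i, j) \<Rightarrow> the_coord i j) = p"
      by (auto simp: pair_of_the_coord)
    show "(case p of (i, j) \<Rightarrow> the_coord i j) \<in> - diag_coords"
      using p by (auto simp: diag_coords_def the_coord_diag_eq)
  qed
  also have "\<dots> = lam * (\<Sum>(i, j)\<in>{(i, j). i < j}. \<bar>mat_of x $ i $ j\<bar>)"
    by (simp add: sum_distrib_left case_prod_unfold)
  finally show ?thesis .
qed

lemma Q_con_mat_of: "Q_con S lam (mat_of x) = (if x \<in> feasible then ereal (objective x) else \<infinity>)"
proof -
  have "inj (\<lambda>i. the_coord i i :: 'p coord)"
    by (auto simp: inj_on_def the_coord_diag_eq)
  then have "(\<Sum>d\<in>diag_coords. - ln (x $ d)) = (\<Sum>i\<in>UNIV. - ln (mat_of x $ i $ i))"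
    by (simp add: diag_coords_def sum.reindex)
  then have "objective x = (\<Sum>i\<in>UNIV. - ln (mat_of x $ i $ i))
      + (1/2 * (\<Sum>i\<in>UNIV. column i (mat_of x) \<bullet> (S *v column i (mat_of x)))
         + lam * (\<Sum>(i, j)\<in>{(i, j). i < j}. \<bar>mat_of x $ i $ j\<bar>))"
    by (simp add: objective_def quad_form_def l1_eq)
  then show ?thesis
    by (auto simp: Q_con_def neg_log_eq feasible_iff)
qed

text \<open>Both sides minimize the same function on the same coordinate line. A diagonal value \<open>0\<close>, which
  the constrained problem admits, has infinite objective and is never chosen.\<close>

lemma coord_step_mat_of:
  assumes x: "x \<in> feasible"
  shows "coord_step S lam (pair_of c) (mat_of x) = mat_of (update c x)"
proof -
  define upd where "upd t = (\<chi> c'. if c' = c then t else x $ c')" for t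
  define u where "u = update c x"
  have u: "coord_optimal c u" "\<And>c'. c' \<noteq> c \<Longrightarrow> u $ c' = x $ c'" "u \<in> feasible"
    using update[where c = c, OF x] by (auto simp: u_def)
  then have upd_u: "upd (u $ c) = u"
    by (simp add: upd_def vec_eq_iff)
  let ?Q = "\<lambda>t. Q_con S lam (set_coord (mat_of x) (pair_of c) t)"
  let ?P = "\<lambda>t::real. fst (pair_of c) = snd (pair_of c) \<longrightarrow> 0 \<le> t"
  have Q: "?Q t = (if upd t \<in> feasible then ereal (objective (upd t)) else \<infinity>)" for t
    unfolding set_coord_mat_of upd_def by (rule Q_con_mat_of)
  have "is_arg_min ?Q ?P t \<longleftrightarrow> t = u $ c" for t
  proof
    have P_u: "?P (u $ c)"
    proof
      assume "fst (pair_of c) = snd (pair_of c)"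
      then have "c = the_coord (snd (pair_of c)) (snd (pair_of c))"
        using the_coord_pair_of[of c] by simp
      then have "c \<in> diag_coords"
        unfolding diag_coords_def by (rule range_eqI)
      then show "0 \<le> u $ c" using u(3) by (auto simp: feasible_def less_imp_le)
    qed
    have min_u: "?Q (u $ c) \<le> ?Q s" for s
      using u(1,3) by (simp add: Q upd_u coord_optimal_def) (simp add: upd_def u(2))
    show "is_arg_min ?Q ?P t" if "t = u $ c"
      using P_u min_u by (simp add: that is_arg_min_linorder)
    show "t = u $ c" if "is_arg_min ?Q ?P t"
    proof -
      have "?Q t \<le> ?Q (u $ c)"
        using that P_u by (simp add: is_arg_min_linorder)
      then have t: "upd t \<in> feasible" "objective (upd t) \<le> objective u"
        using u(3) by (auto simp: Q upd_u split: if_splits)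
      have "coord_optimal c (upd t)"
        unfolding coord_optimal_def
      proof (intro conjI ballI impI t)
        fix y assume y: "y \<in> feasible" "\<forall>c'. c' \<noteq> c \<longrightarrow> y $ c' = upd t $ c'"
        then have "\<forall>c'. c' \<noteq> c \<longrightarrow> y $ c' = u $ c'" using u(2) by (simp add: upd_def)
        then have "objective u \<le> objective y" using u(1) y(1) by (simp add: coord_optimal_def)
        then show "objective (upd t) \<le> objective y" using t(2) by simp
      qed
      moreover have "\<forall>c'. c' \<noteq> c \<longrightarrow> upd t $ c' = x $ c'" by (simp add: upd_def)
      ultimately have "upd t = u"
        using ex1_coord_optimal[OF x, of c] u by blast
      then show ?thesis by (auto simp: upd_def)
    qed
  qed
  then have "coord_min S lam (mat_of x) (pair_of c) = u $ c"
    unfolding coord_min_def by (intro the_equality) simp_all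
  then show ?thesis
    using upd_u by (simp add: coord_step_def set_coord_mat_of upd_def u_def)
qed

lemma concord_pass_mat_of:
  assumes "x \<in> feasible"
  shows "concord_pass S lam (map pair_of cs) (mat_of x) = mat_of (fold update cs x)
    \<and> fold update cs x \<in> feasible"
  using assms
proof (induction cs arbitrary: x)
  case (Cons c cs)
  then show ?case
    using Cons.IH[OF update(3)[OF Cons.prems]] by (simp add: concord_pass_def coord_step_mat_of)
qed (simp add: concord_pass_def)

lemma concord_iterate_mat_of:
  assumes "x \<in> feasible"
  shows "concord_iterate S lam (map pair_of cs) (mat_of x) r = mat_of ((fold update cs ^^ r) x)
    \<and> (fold update cs ^^ r) x \<in> feasible"
  using assms by (induction r) (auto simp: concord_iterate_def concord_pass_mat_of)

lemma concord_iterate_convergent: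
  assumes cs: "distinct cs" "set cs = coords"
    and W: "transpose W = W" and fin: "Q_con S lam W < \<infinity>"
  shows "convergent (concord_iterate S lam cs W)"
proof -
  define cs' where "cs' = map Coord cs"
  have map_cs: "map pair_of cs' = cs"
    using cs(2) by (auto simp: cs'_def o_def Coord_inverse intro!: map_idI)
  then have "distinct cs'"
    using cs(1) distinct_map by metis
  moreover have "set cs' = UNIV"
  proof -
    have "pair_of ` set cs' = set cs"
      using arg_cong[OF map_cs, of set] by simp
    also have "\<dots> = range pair_of"
      by (simp add: cs(2) type_definition.Rep_range[OF type_definition_coord])
    finally have "pair_of ` set cs' = range pair_of" .
    then show ?thesis
      by (simp add: inj_image_eq_iff inj_on_def pair_of_inject)
  qed
  moreover define x where "x = coords_of W"
  have x: "mat_of x = W" using W by (simp add: x_def mat_of_coords_of)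
  then have feas: "x \<in> feasible"
    using fin Q_con_mat_of[of x] by (auto split: if_splits)
  ultimately have "convergent (\<lambda>r. (fold update cs' ^^ r) x)"
    by (intro cyclic_descent_convergent)
  then obtain l where "(\<lambda>r. (fold update cs' ^^ r) x) \<longlonglongrightarrow> l"
    by (auto simp: convergent_def)
  then have "(\<lambda>r. mat_of ((fold update cs' ^^ r) x)) \<longlonglongrightarrow> mat_of l"
    unfolding mat_of_def by (intro tendsto_intros)
  moreover have "concord_iterate S lam cs W = (\<lambda>r. mat_of ((fold update cs' ^^ r) x))"
    using concord_iterate_mat_of[OF feas, of cs'] by (simp add: map_cs x fun_eq_iff)
  ultimately show ?thesis
    by (auto simp: convergent_def)
qed

end

theorem theorem5p1:
  fixes S W0 :: "('p::{finite,linorder}) sqmat"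
    and lam :: real
    and cs :: "('p \<times> 'p) list"
  assumes lam_pos: "lam > 0"
    and S_psd: "psd_matrix S"
    and S_diag: "\<And>i. S $ i $ i > 0"
    and cs_order: "distinct cs" "set cs = coords"
    and W0_sym: "transpose W0 = W0"
    and W0_diag: "\<And>i. W0 $ i $ i \<ge> 0"
    and W0_finite: "Q_con S lam W0 < \<infinity>"
  shows "convergent (concord_iterate S lam cs W0)"
  using concord_iterate_convergent[OF lam_pos S_psd S_diag cs_order W0_sym W0_finite] .

end
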